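(* Let $\rho:(0,\infty)\to(0,\infty)$ be a positive function such that $\lim_{x\to\infty}\rho(x)=0$. Then there exists a Blaschke product $B(z)$ in $\mathbb{C}_+$ without zeros in the domain $\{z\in\mathbb{C}:0<\mathrm{Im}\, z<1\}$ such that $$\liminf_{x\to+\infty}\frac{\log|B(x+i/2)|}{\rho(x)\,x^2}<0.$$
   Context: $\mathbb{C}_+=\{z\in\mathbb{C}:\mathrm{Im}\, z>0\}$. A Blaschke product in $\mathbb{C}_+$ is a function of the form $$B(z)=\prod_{n}\Bigl(\frac{|z_n^2+1|}{z_n^2+1}\cdot\frac{z-z_n}{z-\overline{z_n}}\Bigr)^{k_n},$$ where the $z_n\in\mathbb{C}_+$ are distinct, the $k_n\ge 1$ are integers (multiplicities), $\sum_n k_n\frac{\mathrm{Im}\, z_n}{1+|z_n|^2}<\infty$, and the unimodular factor $|z_n^2+1|/(z_n^2+1)$ is replaced by $1$ if $z_n=i$. The liminf is allowed to be $-\infty$. *)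

theory Defs
  imports "HOL-Analysis.Analysis"
begin

definition upper_half_plane :: "complex set" where
  "upper_half_plane = {w. Im w > 0}"

text \<open>
  For a zero \<open>a\<close> in the upper half-plane, \<open>a\<^sup>2 + 1\<close> vanishes exactly when \<open>a = \<i>\<close>,
  in which case the unimodular factor is taken to be 1.
\<close>

definition blaschke_factor :: "complex \<Rightarrow> complex \<Rightarrow> complex" where
  "blaschke_factor a w =
     (if a = \<i> then 1 else of_real (cmod (a\<^sup>2 + 1)) / (a\<^sup>2 + 1)) * ((w - a) / (w - cnj a))"

text \<open>
  The zeros are indexed by an arbitrary set \<open>I\<close> of natural numbers, which covers finite
  (possibly empty) and infinite products; indices outside \<open>I\<close> contribute the factor 1.
  The relation \<open>has_prod\<close> expresses convergence of the infinite product and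
  admits finitely many vanishing factors, so it is also correct at the zeros.
  Only the values of \<open>B\<close> on the upper half-plane are constrained.
\<close>

definition is_blaschke_product :: "(complex \<Rightarrow> complex) \<Rightarrow> bool" where
  "is_blaschke_product B \<longleftrightarrow>
     (\<exists>(I :: nat set) (z :: nat \<Rightarrow> complex) (k :: nat \<Rightarrow> nat).
        inj_on z I \<and> z ` I \<subseteq> upper_half_plane \<and> (\<forall>n\<in>I. k n \<ge> 1) \<and>
        (\<lambda>n. real (k n) * (Im (z n) / (1 + (cmod (z n))\<^sup>2))) summable_on I \<and>
        (\<forall>w\<in>upper_half_plane.
           (\<lambda>n. if n \<in> I then blaschke_factor (z n) w ^ k n else 1) has_prod B w))"

end

theory Submission
  imports Defs
begin

text \<open>
  All zeros are placed on the line \<open>Im z = 1\<close>: at \<open>x\<^sub>n + \<i>\<close> with multiplicity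
  \<open>k\<^sub>n = \<lceil>\<rho>(x\<^sub>n) x\<^sub>n\<^sup>2\<rceil>\<close>, where \<open>x\<^sub>n\<close> grows so fast that \<open>x\<^sub>n \<ge> 2\<^sup>n\<close> and
  \<open>\<rho>(x\<^sub>n) \<le> 2\<^sup>-\<^sup>n\<close>.  Then \<open>k\<^sub>n / x\<^sub>n\<^sup>2 \<le> \<rho>(x\<^sub>n) + x\<^sub>n\<^sup>-\<^sup>2\<close> is summable, which is the Blaschke
  condition.  A Blaschke factor with zero \<open>x + \<i>\<close> differs from 1 by \<open>O(x\<^sup>-\<^sup>2)\<close> at a fixed point
  (lemma \<open>norm_blaschke_factor_minus_one_le\<close>), so the product converges absolutely.
  At \<open>x\<^sub>n + \<i>/2\<close> the \<open>n\<close>-th factor has modulus \<open>1/3\<close> and all the others have modulus at most 1,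
  so \<open>ln |B(x\<^sub>n + \<i>/2)| \<le> - k\<^sub>n ln 3 \<le> - (ln 3) \<rho>(x\<^sub>n) x\<^sub>n\<^sup>2\<close>, and the lower limit is at most
  \<open>- ln 3\<close>.
\<close>

section \<open>Estimates for a single Blaschke factor\<close>

lemma norm_blaschke_factor:
  assumes "Im a > 0"
  shows "cmod (blaschke_factor a w) = cmod (w - a) / cmod (w - cnj a)"
proof (cases "a = \<i>")
  case True
  then show ?thesis by (simp add: blaschke_factor_def norm_divide)
next
  case False
  have "a\<^sup>2 + 1 = (a - \<i>) * (a + \<i>)"
    by (simp add: algebra_simps power2_eq_square)
  moreover have "a + \<i> \<noteq> 0"
    using assms by (auto simp: complex_eq_iff)
  ultimately have "a\<^sup>2 + 1 \<noteq> 0"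
    using False by simp
  then show ?thesis
    using False by (simp add: blaschke_factor_def norm_mult norm_divide)
qed

lemma norm_blaschke_factor_le_1:
  assumes "Im a > 0" "Im w > 0"
  shows "cmod (blaschke_factor a w) \<le> 1"
proof -
  have "(Im w - Im a)\<^sup>2 \<le> (Im w + Im a)\<^sup>2"
    using assms by (intro power2_mono) auto
  then have "cmod (w - a) \<le> cmod (w - cnj a)"
    by (simp add: cmod_def)
  then show ?thesis
    by (auto simp: norm_blaschke_factor assms divide_le_eq_1)
qed

lemma blaschke_factor_eq_0_iff:
  assumes "Im a > 0" "Im w > 0"
  shows "blaschke_factor a w = 0 \<longleftrightarrow> w = a"
proof -
  have "w \<noteq> cnj a"
    using assms by (auto simp: complex_eq_iff)
  then have "cmod (blaschke_factor a w) = 0 \<longleftrightarrow> w = a"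
    by (simp add: norm_blaschke_factor assms)
  then show ?thesis by simp
qed

text \<open>
  Without the unimodular factor the difference would only be \<open>O(1/x)\<close>; that factor cancels the
  term of first order.
\<close>

lemma norm_blaschke_factor_minus_one_le:
  fixes x :: real
  assumes "1 \<le> x" "2 * cmod w \<le> x" "0 < Im w"
  shows "cmod (blaschke_factor (Complex x 1) w - 1) \<le> (8 * cmod w + 12) / x\<^sup>2"
proof -
  define a where "a = Complex x 1"
  define s where "s = cmod (Complex x 2)"
  define D where "D = Complex x 2 * (w - cnj a)"
  have sx: "x \<le> s" "s - x \<le> 2 / x"
  proof -
    show "x \<le> s"
      using complex_Re_le_cmod[of "Complex x 2"] by (simp add: s_def)
    \<comment> \<open>\<open>s\<^sup>2 = x\<^sup>2 + 4 \<le> (x + 2/x)\<^sup>2\<close>\<close>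
    have "s \<le> x + 2 / x"
      unfolding s_def cmod_def using assms
      by (intro real_le_lsqrt) (auto simp: power2_sum power_divide)
    then show "s - x \<le> 2 / x" by simp
  qed
  have sx2: "\<bar>x - s\<bar> \<le> 2 / x" using sx by simp
  have "w \<noteq> cnj a"
    using assms by (auto simp: a_def complex_eq_iff)
  moreover have "Complex x 2 \<noteq> 0"
    by (simp add: complex_eq_iff)
  ultimately have D0: "D \<noteq> 0"
    by (simp add: D_def)
  have eq: "a\<^sup>2 + 1 = of_real x * Complex x 2"
    by (simp add: a_def complex_eq_iff power2_eq_square)
  have "a \<noteq> \<i>" using assms by (simp add: a_def complex_eq_iff)
  moreover have "of_real (cmod (a\<^sup>2 + 1)) / (a\<^sup>2 + 1) = of_real s / Complex x 2"
    unfolding eq using assms by (simp add: norm_mult s_def)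
  ultimately have "blaschke_factor a w = of_real s * (w - a) / D"
    by (simp add: blaschke_factor_def D_def)
  then have "blaschke_factor a w - 1 = (of_real s * (w - a) - D) / D"
    using D0 by (simp add: field_simps)
  \<comment> \<open>The terms of order \<open>x\<close> enter only through \<open>x - s = O(1/x)\<close>, so the numerator stays bounded.\<close>
  also have "of_real s * (w - a) - D =
      - (of_real (x - s) * (w - of_real x) + 2 * \<i> * w - 2 - of_real (x - s) * \<i>)"
    by (simp add: D_def a_def complex_eq_iff algebra_simps)
  finally have "cmod (blaschke_factor a w - 1) =
      cmod (of_real (x - s) * (w - of_real x) + 2 * \<i> * w - 2 - of_real (x - s) * \<i>) / cmod D"
    by (simp only: norm_divide norm_minus_cancel)
  also have "\<dots> \<le> (4 * cmod w + 6) / (x * (x / 2))"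
  proof (rule frac_le)
    have "cmod (of_real (x - s) * (w - of_real x) + 2 * \<i> * w - 2 - of_real (x - s) * \<i>)
        \<le> cmod (of_real (x - s) * (w - of_real x)) + cmod (2 * \<i> * w) + cmod 2
           + cmod (of_real (x - s) * \<i>)"
      by (intro order_trans[OF norm_triangle_ineq4] order_trans[OF norm_triangle_ineq]
          add_mono order_refl)
    also have "\<dots> = \<bar>x - s\<bar> * cmod (w - of_real x) + 2 * cmod w + 2 + \<bar>x - s\<bar>"
      by (simp add: norm_mult del: of_real_diff)
    also have "\<dots> \<le> 2 / x * (cmod w + x) + 2 * cmod w + 2 + 2 / x"
      using sx2 assms norm_triangle_ineq4[of w "of_real x"]
      by (intro add_mono mult_mono order_refl) auto
    also have "\<dots> = (2 / x) * cmod w + 2 * cmod w + 4 + 2 / x"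
      using assms by (simp add: field_simps)
    also have "\<dots> \<le> 2 * cmod w + 2 * cmod w + 4 + 2"
      using assms by (intro add_mono mult_right_mono order_refl) (auto simp: divide_le_eq)
    finally show "cmod (of_real (x - s) * (w - of_real x) + 2 * \<i> * w - 2 - of_real (x - s) * \<i>)
        \<le> 4 * cmod w + 6" by simp
    have "x / 2 \<le> x - cmod w" using assms by simp
    also have "\<dots> \<le> \<bar>Re (w - cnj a)\<bar>"
      using complex_Re_le_cmod[of w] by (simp add: a_def)
    also have "\<dots> \<le> cmod (w - cnj a)" by (rule abs_Re_le_cmod)
    finally show "x * (x / 2) \<le> cmod D"
      unfolding D_def norm_mult using sx assms by (intro mult_mono) (auto simp: s_def)
  qed (use assms in auto)
  also have "\<dots> = (8 * cmod w + 12) / x\<^sup>2"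
    using assms by (simp add: field_simps power2_eq_square)
  finally show ?thesis by (simp add: a_def)
qed

section \<open>Infinite products with zeros on a horizontal line\<close>

lemma convergent_prod_blaschke_factors:
  fixes x :: "nat \<Rightarrow> real" and k :: "nat \<Rightarrow> nat"
  assumes x: "filterlim x at_top sequentially"
    and sm: "summable (\<lambda>n. real (k n) / (x n)\<^sup>2)"
    and w: "Im w > 0"
  shows "convergent_prod (\<lambda>n. blaschke_factor (Complex (x n) 1) w ^ k n)"
proof -
  have "eventually (\<lambda>n. max 1 (2 * cmod w) \<le> x n) sequentially"
    using x unfolding filterlim_at_top by blast
  then have "eventually (\<lambda>n. norm (cmod (blaschke_factor (Complex (x n) 1) w ^ k n - 1))
      \<le> (8 * cmod w + 12) * (real (k n) / (x n)\<^sup>2)) sequentially"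
  proof eventually_elim
    case (elim n)
    have "cmod (blaschke_factor (Complex (x n) 1) w ^ k n - 1 ^ k n)
        \<le> real (k n) * cmod (blaschke_factor (Complex (x n) 1) w - 1)"
      by (rule norm_power_diff) (use w in \<open>auto intro: norm_blaschke_factor_le_1\<close>)
    also have "\<dots> \<le> real (k n) * ((8 * cmod w + 12) / (x n)\<^sup>2)"
      by (intro mult_left_mono norm_blaschke_factor_minus_one_le) (use elim w in auto)
    finally show ?case by (simp add: mult_ac)
  qed
  then have "summable (\<lambda>n. cmod (blaschke_factor (Complex (x n) 1) w ^ k n - 1))"
    by (rule summable_comparison_test_ev) (intro summable_mult sm)
  then have "abs_convergent_prod (\<lambda>n. blaschke_factor (Complex (x n) 1) w ^ k n)"
    by (simp add: abs_convergent_prod_conv_summable)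
  then show ?thesis by (rule abs_convergent_prod_imp_convergent_prod)
qed

lemma norm_prodinf_le_norm_factor:
  fixes f :: "nat \<Rightarrow> complex"
  assumes "convergent_prod f" "\<And>n. cmod (f n) \<le> 1"
  shows "cmod (prodinf f) \<le> cmod (f m)"
proof (rule LIMSEQ_le_const2)
  show "(\<lambda>n. cmod (\<Prod>i\<le>n. f i)) \<longlonglongrightarrow> cmod (prodinf f)"
    using convergent_prod_LIMSEQ[OF assms(1)] by (rule tendsto_norm)
  have "cmod (\<Prod>i\<le>n. f i) \<le> cmod (f m)" if "m \<le> n" for n
  proof -
    have "cmod (\<Prod>i\<le>n. f i) = cmod (f m) * (\<Prod>i\<in>{..n}-{m}. cmod (f i))"
      using that by (simp add: norm_mult prod.remove[of _ m] flip: prod_norm)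
    also have "\<dots> \<le> cmod (f m) * 1"
      using assms(2) by (intro mult_left_mono prod_le_1) auto
    finally show ?thesis by simp
  qed
  then show "\<exists>N. \<forall>n\<ge>N. cmod (\<Prod>i\<le>n. f i) \<le> cmod (f m)" by blast
qed

section \<open>Rapidly growing sequences and lower limits\<close>

lemma exists_rapid_sequence:
  fixes \<rho> :: "real \<Rightarrow> real"
  assumes "(\<rho> \<longlongrightarrow> 0) at_top"
  obtains x :: "nat \<Rightarrow> real"
  where "strict_mono x" "\<And>n. 2 ^ n \<le> x n" "\<And>n. \<rho> (x n) \<le> (1 / 2) ^ n"
proof -
  have "\<exists>X. \<forall>x\<ge>X. \<rho> x \<le> (1 / 2) ^ n" for n :: nat
  proof -
    have "eventually (\<lambda>x. \<rho> x < (1 / 2) ^ n) at_top"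
      using assms by (rule order_tendstoD) simp
    then show ?thesis
      by (auto simp: eventually_at_top_linorder intro: less_imp_le)
  qed
  then obtain X where X: "\<And>n x. X n \<le> x \<Longrightarrow> \<rho> x \<le> (1 / 2) ^ n"
    by metis
  \<comment> \<open>Every summand is positive, so \<open>x\<close> increases strictly, and \<open>x n\<close> is at least its last summand.\<close>
  define x where "x n = (\<Sum>i\<le>n. max 0 (X i) + 2 ^ i)" for n :: nat
  have *: "max 0 (X n) + 2 ^ n \<le> x n" for n
    unfolding x_def by (rule member_le_sum) (auto intro: add_nonneg_nonneg)
  show ?thesis
  proof
    have "0 < max 0 (X n) + 2 ^ n" for n
      by (rule add_nonneg_pos) auto
    then have "x n < x (Suc n)" for n
      unfolding x_def by (metis less_add_same_cancel1 sum.atMost_Suc)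
    then show "strict_mono x"
      by (simp add: strict_mono_Suc_iff)
    show "2 ^ n \<le> x n" for n using *[of n] by linarith
    have "0 \<le> (2 :: real) ^ n" for n by simp
    then show "\<rho> (x n) \<le> (1 / 2) ^ n" for n using *[of n] by (intro X) (smt (verit))
  qed
qed

lemma Liminf_at_top_le_along_sequence:
  fixes f :: "real \<Rightarrow> ereal"
  assumes "filterlim x at_top sequentially" "\<And>n. f (x n) \<le> c"
  shows "Liminf at_top f \<le> c"
proof (rule ccontr)
  assume "\<not> Liminf at_top f \<le> c"
  then have "eventually (\<lambda>t. c < f t) at_top"
    by (auto intro: less_LiminfD)
  then have "eventually (\<lambda>n. c < f (x n)) sequentially"
    using assms(1) by (rule eventually_compose_filterlim)
  then obtain n where "c < f (x n)"
    by (auto simp: eventually_sequentially)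
  then show False using assms(2)[of n] by simp
qed

section \<open>A Blaschke product that is small along a sequence\<close>

theorem proposition2p3:
  fixes \<rho> :: "real \<Rightarrow> real"
  assumes "\<And>x. x > 0 \<Longrightarrow> \<rho> x > 0"
    and "(\<rho> \<longlongrightarrow> 0) at_top"
  shows "\<exists>B. is_blaschke_product B \<and>
           (\<forall>w. 0 < Im w \<and> Im w < 1 \<longrightarrow> B w \<noteq> 0) \<and>
           Liminf at_top (\<lambda>x::real. ereal (ln (cmod (B (of_real x + \<i> / 2))) / (\<rho> x * x\<^sup>2))) < 0"
proof -
  obtain x where x: "strict_mono x" "\<And>n. 2 ^ n \<le> x n" "\<And>n. \<rho> (x n) \<le> (1 / 2) ^ n"
    using exists_rapid_sequence[OF assms(2)] by metis
  have x1: "1 \<le> x n" for n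
    using x(2)[of n] one_le_power[of "2::real" n] by linarith
  have xpos: "0 < x n" for n
    using x1[of n] by simp
  have xlim: "filterlim x at_top sequentially"
  proof (rule filterlim_at_top_mono)
    show "filterlim real at_top sequentially"
      by (rule filterlim_real_sequentially)
    have "real n \<le> x n" for n
      using of_nat_less_two_power[of n, where 'a = real] x(2)[of n] by linarith
    then show "eventually (\<lambda>n. real n \<le> x n) sequentially"
      by simp
  qed
  define k where "k n = nat \<lceil>\<rho> (x n) * (x n)\<^sup>2\<rceil>" for n
  define z where "z n = Complex (x n) 1" for n
  have rpos: "0 < \<rho> (x n) * (x n)\<^sup>2" for n
    using assms(1)[OF xpos] xpos[of n] by simp
  have k_ge: "\<rho> (x n) * (x n)\<^sup>2 \<le> real (k n)" for n
    unfolding k_def by (rule real_nat_ceiling_ge)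
  have k_le: "real (k n) \<le> \<rho> (x n) * (x n)\<^sup>2 + 1" for n
    using rpos[of n] unfolding k_def by linarith
  have k1: "1 \<le> k n" for n
    using rpos[of n] by (simp add: k_def Suc_le_eq)
  have sm: "summable (\<lambda>n. real (k n) / (x n)\<^sup>2)"
  proof (rule summable_comparison_test)
    have "real (k n) / (x n)\<^sup>2 \<le> 2 * (1 / 2) ^ n" for n
    proof -
      have "real (k n) / (x n)\<^sup>2 \<le> (\<rho> (x n) * (x n)\<^sup>2 + 1) / (x n)\<^sup>2"
        by (intro divide_right_mono k_le) simp
      also have "\<dots> = \<rho> (x n) + 1 / (x n)\<^sup>2"
        using xpos[of n] by (simp add: field_simps)
      also have "1 / (x n)\<^sup>2 \<le> 1 / 2 ^ n"
      proof (rule divide_left_mono)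
        have "2 ^ n \<le> x n * 1" using x(2) by simp
        also have "\<dots> \<le> (x n)\<^sup>2"
          unfolding power2_eq_square using x1[of n] by (intro mult_left_mono) auto
        finally show "2 ^ n \<le> (x n)\<^sup>2" .
      qed (use xpos[of n] in auto)
      finally show ?thesis using x(3)[of n] by (simp add: power_divide)
    qed
    then show "\<exists>N. \<forall>n\<ge>N. norm (real (k n) / (x n)\<^sup>2) \<le> 2 * (1 / 2) ^ n"
      by simp
    show "summable (\<lambda>n. 2 * (1 / 2 :: real) ^ n)"
      by (intro summable_mult summable_geometric) simp
  qed
  define F where "F w n = blaschke_factor (z n) w ^ k n" for w n
  define B where "B w = prodinf (F w)" for w
  have conv: "convergent_prod (F w)" if "0 < Im w" for w
    unfolding F_def z_def by (rule convergent_prod_blaschke_factors[OF xlim sm that])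
  have Fle: "cmod (F w n) \<le> 1" if "0 < Im w" for w n
    unfolding F_def norm_power
    by (intro power_le_one norm_blaschke_factor_le_1) (use that in \<open>auto simp: z_def\<close>)
  have B_nz: "B w \<noteq> 0" if "0 < Im w" "Im w < 1" for w
    unfolding B_def
  proof (rule prodinf_nonzero)
    show "convergent_prod (F w)" by (rule conv) fact
    have "w \<noteq> z n" for n using that by (auto simp: z_def)
    then show "F w n \<noteq> 0" for n
      using that by (simp add: F_def blaschke_factor_eq_0_iff z_def)
  qed
  have "is_blaschke_product B"
    unfolding is_blaschke_product_def
  proof (intro exI conjI ballI)
    show "inj_on z UNIV"
      using strict_mono_imp_inj_on[OF x(1)] by (auto simp: inj_on_def z_def)
    show "z ` UNIV \<subseteq> upper_half_plane"
      by (auto simp: z_def upper_half_plane_def)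
    show "k n \<ge> 1" for n by (rule k1)
    have "summable (\<lambda>n. real (k n) * (Im (z n) / (1 + (cmod (z n))\<^sup>2)))"
    proof (rule summable_comparison_test[OF _ sm], intro exI allI impI)
      fix n
      have "real (k n) / (1 + (cmod (z n))\<^sup>2) \<le> real (k n) / (x n)\<^sup>2"
        using xpos[of n]
        by (intro divide_left_mono) (auto simp: z_def cmod_power2 intro!: mult_pos_pos add_pos_pos)
      then show "norm (real (k n) * (Im (z n) / (1 + (cmod (z n))\<^sup>2))) \<le> real (k n) / (x n)\<^sup>2"
        by (simp add: z_def abs_of_nonneg)
    qed
    then show "(\<lambda>n. real (k n) * (Im (z n) / (1 + (cmod (z n))\<^sup>2))) summable_on UNIV"
      by (subst summable_on_UNIV_nonneg_real_iff) (auto simp: z_def)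
    fix w assume "w \<in> upper_half_plane"
    then have "F w has_prod B w"
      unfolding B_def by (intro convergent_prod_has_prod conv) (simp add: upper_half_plane_def)
    then show "(\<lambda>n. if n \<in> UNIV then blaschke_factor (z n) w ^ k n else 1) has_prod B w"
      by (simp add: F_def[abs_def])
  qed
  moreover have "Liminf at_top
      (\<lambda>x. ereal (ln (cmod (B (of_real x + \<i> / 2))) / (\<rho> x * x\<^sup>2))) \<le> ereal (- ln 3)"
  proof (rule Liminf_at_top_le_along_sequence[OF xlim])
    fix n
    let ?w = "of_real (x n) + \<i> / 2"
    have w: "0 < Im ?w" "Im ?w < 1" by auto
    have "cmod (B ?w) \<le> cmod (F ?w n)"
      unfolding B_def by (rule norm_prodinf_le_norm_factor[OF conv[OF w(1)] Fle[OF w(1)]])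
    also have "cmod (F ?w n) = (1 / 3) ^ k n"
    proof -
      have "?w - z n = of_real (- 1 / 2) * \<i>" "?w - cnj (z n) = of_real (3 / 2) * \<i>"
        by (auto simp: z_def complex_eq_iff)
      then have "cmod (?w - z n) = 1 / 2" "cmod (?w - cnj (z n)) = 3 / 2"
        by (simp_all only: norm_mult norm_of_real norm_ii)
      moreover have "cmod (blaschke_factor (z n) ?w) = cmod (?w - z n) / cmod (?w - cnj (z n))"
        by (rule norm_blaschke_factor) (simp add: z_def)
      ultimately have "cmod (blaschke_factor (z n) ?w) = (1 / 2) / (3 / 2)"
        by (simp only:)
      also have "\<dots> = 1 / 3" by simp
      finally show ?thesis by (simp only: F_def norm_power)
    qed
    \<comment> \<open>Monotonicity of \<open>ln\<close> needs \<open>B\<close> to be nonzero here, since \<open>ln 0 = 0\<close> by convention.\<close>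
    finally have "ln (cmod (B ?w)) \<le> ln ((1 / 3) ^ k n)"
      using B_nz[OF w] by (intro ln_mono) auto
    also have "\<dots> = - (real (k n) * ln 3)"
      by (simp add: ln_realpow ln_div)
    also have "\<dots> \<le> - (\<rho> (x n) * (x n)\<^sup>2 * ln 3)"
      using k_ge[of n] by (simp add: mult_right_mono)
    finally have "ln (cmod (B ?w)) / (\<rho> (x n) * (x n)\<^sup>2) \<le> - ln 3"
      using rpos[of n] by (simp add: pos_divide_le_eq mult.commute)
    then show "ereal (ln (cmod (B ?w)) / (\<rho> (x n) * (x n)\<^sup>2)) \<le> ereal (- ln 3)"
      by simp
  qed
  then have "Liminf at_top
      (\<lambda>x. ereal (ln (cmod (B (of_real x + \<i> / 2))) / (\<rho> x * x\<^sup>2))) < 0"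
    by (rule order_le_less_trans) simp
  ultimately show ?thesis using B_nz by blast
qed

end
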